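(* Let $G$ be a graph on $n$ vertices, with $n \geq 2$, obtained from a bipartite graph by repeated splitting of vertices into adjacent twins. Then $G$ admits a universal line or has at least $n$ distinct lines.
   Context: All graphs are finite and simple. A graph $G$ is viewed as the metric space $(V(G),\mathrm{dist})$ where $\mathrm{dist}$ is the shortest-path distance (equal to $\infty$ between vertices in different components). A vertex $b$ is between $a$ and $c$ if $\mathrm{dist}(a,b)+\mathrm{dist}(b,c)=\mathrm{dist}(a,c)$. Three vertices are collinear if they are pairwise distinct and one of them is between the other two. For distinct vertices $a,b$, the line generated by $a$ and $b$, denoted $\overline{ab}$, is the set $\{a,b\}$ together with all vertices $c$ such that $a,b,c$ are collinear. A line is universal if it equals the whole vertex set. Two lines are distinct if they are different as sets of vertices. Splitting a vertex $v$ into adjacent twins means adding a new vertex $v'$ adjacent to $v$ and to every neighbor of $v$ (and to nothing else). "Obtained from a bipartite graph by repeated splitting" means obtained from some bipartite graph by applying this operation finitely many times (possibly zero times). *)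

theory Defs
  imports "Graph_Theory.Graph_Theory"
begin

text \<open>Finite simple graphs are the \<open>pair_graph\<close>s: finite, loop-free, with a symmetric arc set.\<close>

text \<open>Unit arc costs, so a walk costs its number of edges. The value is \<open>\<infinity>\<close> exactly for vertices in
  different components, and betweenness uses \<open>ereal\<close> addition, where \<open>\<infinity> + x = \<infinity>\<close> for \<open>x \<ge> 0\<close>.\<close>

definition gdist :: "'a pair_pre_digraph \<Rightarrow> 'a \<Rightarrow> 'a \<Rightarrow> ereal" where
  "gdist G u v = wf_digraph.\<mu> (with_proj G) (\<lambda>_. 1) u v"

definition between :: "'a pair_pre_digraph \<Rightarrow> 'a \<Rightarrow> 'a \<Rightarrow> 'a \<Rightarrow> bool" where
  "between G a b c \<longleftrightarrow> gdist G a b + gdist G b c = gdist G a c"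

definition collinear3 :: "'a pair_pre_digraph \<Rightarrow> 'a \<Rightarrow> 'a \<Rightarrow> 'a \<Rightarrow> bool" where
  "collinear3 G a b c \<longleftrightarrow> a \<noteq> b \<and> a \<noteq> c \<and> b \<noteq> c \<and>
     (between G b a c \<or> between G a b c \<or> between G a c b)"

definition line :: "'a pair_pre_digraph \<Rightarrow> 'a \<Rightarrow> 'a \<Rightarrow> 'a set" where
  "line G a b = {a, b} \<union> {c \<in> pverts G. collinear3 G a b c}"

definition lines :: "'a pair_pre_digraph \<Rightarrow> 'a set set" where
  "lines G = {line G a b | a b. a \<in> pverts G \<and> b \<in> pverts G \<and> a \<noteq> b}"

definition has_universal_line :: "'a pair_pre_digraph \<Rightarrow> bool" where
  "has_universal_line G \<longleftrightarrow> (\<exists>L \<in> lines G. L = pverts G)"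

definition bipartite :: "'a pair_pre_digraph \<Rightarrow> bool" where
  "bipartite G \<longleftrightarrow> (\<exists>U W. pverts G = U \<union> W \<and> U \<inter> W = {} \<and> parcs G \<subseteq> U \<times> W \<union> W \<times> U)"

definition split_twin :: "'a pair_pre_digraph \<Rightarrow> 'a \<Rightarrow> 'a \<Rightarrow> 'a pair_pre_digraph" where
  "split_twin G v v' =
     \<lparr> pverts = insert v' (pverts G),
       parcs = parcs G \<union> {(v, v'), (v', v)}
         \<union> {(v', u) | u. (v, u) \<in> parcs G} \<union> {(u, v') | u. (v, u) \<in> parcs G} \<rparr>"

text \<open>Keeping all graphs on one vertex type loses no generality: every graph in a splitting sequence
  lives on a subset of the final vertex set.\<close>

inductive split_from_bipartite :: "'a pair_pre_digraph \<Rightarrow> bool" where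
  base: "pair_graph G \<Longrightarrow> bipartite G \<Longrightarrow> split_from_bipartite G"
| split: "split_from_bipartite G \<Longrightarrow> v \<in> pverts G \<Longrightarrow> v' \<notin> pverts G \<Longrightarrow>
    split_from_bipartite (split_twin G v v')"

lemma gdist_eq_length:
  assumes "pair_graph G"
  shows "gdist G u v = (INF p \<in> {p. pre_digraph.awalk (with_proj G) u p v}. ereal (length p))"
proof -
  interpret pair_graph G by fact
  have "awalk_cost (\<lambda>_. 1) p = length p" for p :: "('a \<times> 'a) list"
    by (induct p) auto
  then show ?thesis by (simp add: gdist_def \<mu>_def)
qed

lemma pair_graph_split_twin:
  assumes "pair_graph G" "v \<in> pverts G" "v' \<notin> pverts G"
  shows "pair_graph (split_twin G v v')"
proof -
  interpret pair_graph G by fact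
  have sym: "(x, y) \<in> parcs G \<Longrightarrow> (y, x) \<in> parcs G" for x y
    using pair_sym_arcs by (auto simp: symmetric_def dest: symD)
  have "{(v', u) | u. (v, u) \<in> parcs G} \<subseteq> {v'} \<times> pverts G"
    "{(u, v') | u. (v, u) \<in> parcs G} \<subseteq> pverts G \<times> {v'}"
    using in_arcsD2 by auto
  then have fin: "finite {(v', u) | u. (v, u) \<in> parcs G}" "finite {(u, v') | u. (v, u) \<in> parcs G}"
    by (meson finite.emptyI finite.insertI finite_SigmaI finite_subset pair_finite_verts)+
  show ?thesis
    using assms(2,3) fin pair_finite_verts pair_finite_arcs
    by unfold_locales
      (auto simp: split_twin_def symmetric_def intro!: symI dest: sym in_arcsD1 in_arcsD2 no_loops')
qed

lemma split_from_bipartite_pair_graph: "split_from_bipartite G \<Longrightarrow> pair_graph G"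
  by (induction rule: split_from_bipartite.induct) (auto intro: pair_graph_split_twin)

end

theory Submission
  imports Defs
begin

text \<open>
  Vertices in different components generate a universal line, so let \<open>G\<close> be connected. It is a
  bipartite graph whose vertices have been blown up to cliques, the classes. Call a vertex twinned if
  its class has at least two elements, and let \<open>P\<close> and \<open>S\<close> be the sets of twinned and untwinned
  vertices. Adjacent untwinned vertices generate a universal line by parity of distances, so suppose
  that \<open>S\<close> is independent.

  Two vertices of one class generate a line of size two, while a line generated by vertices of
  different classes cuts exactly the non-trivial classes of its generators. Hence the pairs inside
  \<open>P\<close>, the pairs \<open>{s, x}\<close> with \<open>s \<in> S\<close> fixed and \<open>x \<in> P\<close>, and the pairs of untwinned neighbours of
  one vertex \<open>v \<in> P\<close> (which are mutually at distance 2) all generate different lines. Choose \<open>v\<close>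
  with the largest number \<open>k\<close> of untwinned neighbours and let \<open>N = card P\<close>. Every vertex of \<open>S\<close> has
  at least two neighbours in \<open>P\<close>, so \<open>2 * card S \<le> N * k\<close>, and therefore
  \<open>(N choose 2) + N + (k choose 2) \<ge> N + card S\<close>.
\<close>

section \<open>Lines in finite metric spaces with twins\<close>

definition pairs :: "'a set \<Rightarrow> 'a set set" where
  "pairs X = {e. e \<subseteq> X \<and> card e = 2}"

lemma card_pairs: "finite X \<Longrightarrow> card (pairs X) = card X choose 2"
  unfolding pairs_def by (rule n_subsets)

lemma finite_pairs: "finite X \<Longrightarrow> finite (pairs X)"
  unfolding pairs_def by (rule finite_subset[of _ "Pow X"]) auto

lemma choose_two_twice: "2 * (n choose 2) = n * (n - 1)" for n :: nat
  by (cases n) (auto simp: choose_two)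

lemma product_le_choose_two:
  assumes "N \<ge> (2::nat)"
  shows "N * k \<le> 2 * (N choose 2) + 2 * (k choose 2)"
proof (cases "k = 0")
  case False
  define M where "M = int N"
  define j where "j = int k"
  have "M * j \<le> M * (M - 1) + j * (j - 1)"
  proof (cases "M = j")
    case True
    then show ?thesis using assms by (auto simp: M_def algebra_simps)
  next
    case False
    have "(M - j)^2 \<ge> 1" using False by (smt (verit) zero_less_power2)
    moreover have "(M - 1) * (j - 1) \<ge> 0" using assms \<open>k \<noteq> 0\<close> by (auto simp: M_def j_def)
    ultimately show ?thesis by (simp add: algebra_simps power2_eq_square)
  qed
  moreover have "int (N * (N - 1) + k * (k - 1)) = M * (M - 1) + j * (j - 1)"
    using assms False by (simp add: M_def j_def of_nat_diff)
  moreover have "int (N * k) = M * j"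
    by (simp add: M_def j_def)
  ultimately have "N * k \<le> N * (N - 1) + k * (k - 1)"
    by linarith
  then show ?thesis unfolding choose_two_twice by linarith
qed simp

locale twin_metric =
  fixes V :: "'a set" and d :: "'a \<Rightarrow> 'a \<Rightarrow> nat" and cls :: "'a \<Rightarrow> 'b"
  assumes finite_V: "finite V"
    and d_zero: "x \<in> V \<Longrightarrow> y \<in> V \<Longrightarrow> d x y = 0 \<longleftrightarrow> x = y"
    and d_sym: "x \<in> V \<Longrightarrow> y \<in> V \<Longrightarrow> d x y = d y x"
    and d_triangle: "x \<in> V \<Longrightarrow> y \<in> V \<Longrightarrow> z \<in> V \<Longrightarrow> d x z \<le> d x y + d y z"
    and d_twin: "x \<in> V \<Longrightarrow> y \<in> V \<Longrightarrow> cls x = cls y \<Longrightarrow> x \<noteq> y \<Longrightarrow> d x y = 1"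
    and d_twin_eq: "x \<in> V \<Longrightarrow> y \<in> V \<Longrightarrow> z \<in> V \<Longrightarrow> cls x = cls y \<Longrightarrow> cls z \<noteq> cls x \<Longrightarrow> d x z = d y z"
begin

definition pair_line :: "'a set \<Rightarrow> 'a set" where
  "pair_line e = e \<union> {c \<in> V - e. \<exists>a\<in>e. \<exists>b\<in>e. a \<noteq> b \<and>
     (d a b + d b c = d a c \<or> d a c + d c b = d a b)}"

definition twinned :: "'a set" where
  "twinned = {x \<in> V. \<exists>y\<in>V. y \<noteq> x \<and> cls y = cls x}"

definition partial :: "'a set \<Rightarrow> 'a set" where
  "partial L = {x \<in> L. \<exists>y\<in>V. cls y = cls x \<and> y \<notin> L}"

lemma pair_line_iff:
  assumes "a \<in> V" "b \<in> V" "a \<noteq> b" "c \<in> V" "c \<noteq> a" "c \<noteq> b"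
  shows "c \<in> pair_line {a, b} \<longleftrightarrow>
    d a b + d b c = d a c \<or> d a b + d a c = d b c \<or> d a c + d b c = d a b"
  using assms d_sym[of a b] d_sym[of a c] d_sym[of b c] by (auto simp: pair_line_def)

lemma subset_pair_line: "e \<subseteq> pair_line e"
  by (auto simp: pair_line_def)

lemma pair_line_subset: "e \<subseteq> V \<Longrightarrow> pair_line e \<subseteq> V"
  by (auto simp: pair_line_def)

lemma twin_notin_pair_line:
  assumes "a \<in> V" "b \<in> V" "cls a \<noteq> cls b" "y \<in> V" "cls y = cls a" "y \<noteq> a"
  shows "y \<notin> pair_line {a, b}"
proof -
  have "d a b = d y b" using d_twin_eq[of a y b] assms by auto
  moreover have "d a y = 1" using d_twin[of a y] assms by auto
  moreover have "d y b = d b y" "d b y \<noteq> 0" using d_sym[of y b] d_zero[of b y] assms by auto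
  moreover have "a \<noteq> b" "y \<noteq> b" using assms by auto
  ultimately show ?thesis using pair_line_iff[of a b y] assms by auto
qed

lemma pair_line_twins:
  assumes "a \<in> V" "b \<in> V" "a \<noteq> b" "cls a = cls b"
  shows "pair_line {a, b} = {a, b}"
proof -
  have "c \<notin> pair_line {a, b}" if c: "c \<in> V" "c \<noteq> a" "c \<noteq> b" for c
  proof (cases "cls c = cls a")
    case True
    then have "d a b = 1" "d a c = 1" "d b c = 1" using d_twin assms c by auto
    then show ?thesis using pair_line_iff[of a b c] assms c by auto
  next
    case False
    then have "d a b = 1" "d a c = d b c" using d_twin[of a b] d_twin_eq[of a b c] assms c by auto
    moreover from this have "d a b + d b c \<noteq> d a c" "d a b + d a c \<noteq> d b c" "d a c + d b c \<noteq> d a b"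
      by presburger+
    ultimately show ?thesis using pair_line_iff[of a b c] assms c by blast
  qed
  then show ?thesis using subset_pair_line[of "{a, b}"] pair_line_subset[of "{a, b}"] assms by blast
qed

lemma partial_pair_line:
  assumes a: "a \<in> V" and b: "b \<in> V" and ab: "cls a \<noteq> cls b"
  shows "partial (pair_line {a, b}) = {a, b} \<inter> twinned"
proof
  have comm: "{b, a} = {a, b}" by auto
  show "{a, b} \<inter> twinned \<subseteq> partial (pair_line {a, b})"
    using twin_notin_pair_line[OF a b ab] twin_notin_pair_line[OF b a] ab
      subset_pair_line[of "{a, b}"]
    unfolding partial_def twinned_def comm by fastforce
  show "partial (pair_line {a, b}) \<subseteq> {a, b} \<inter> twinned"
  proof
    fix x assume "x \<in> partial (pair_line {a, b})"
    then obtain y where x: "x \<in> pair_line {a, b}" "x \<in> V"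
      and y: "y \<in> V" "cls y = cls x" "y \<notin> pair_line {a, b}"
      using pair_line_subset[of "{a, b}"] a b by (auto simp: partial_def)
    have "x \<in> twinned" using x y unfolding twinned_def by auto
    moreover have "x = a \<or> x = b"
    proof (rule ccontr)
      assume "\<not> (x = a \<or> x = b)"
      then have ne: "x \<noteq> a" "x \<noteq> b" by auto
      have "cls x \<noteq> cls a" "cls x \<noteq> cls b"
        using twin_notin_pair_line[OF a b ab x(2)] twin_notin_pair_line[OF b a _ x(2)] ab x(1) ne
        unfolding comm by auto
      then have "d x a = d y a" "d x b = d y b" "y \<noteq> a" "y \<noteq> b"
        using d_twin_eq[of x y] x y a b by auto
      then show False
        using pair_line_iff[of a b x] pair_line_iff[of a b y] x y ne a b ab
          d_sym[of a x] d_sym[of a y] d_sym[of b x] d_sym[of b y] by auto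
    qed
    ultimately show "x \<in> {a, b} \<inter> twinned" by auto
  qed
qed

lemma pair_line_eq_imp:
  assumes e: "e \<subseteq> V" "card e = 2" and f: "f \<subseteq> V" "card f = 2"
    and eq: "pair_line e = pair_line f"
  shows "e \<inter> twinned = f \<inter> twinned"
proof -
  obtain a b where ab: "e = {a, b}" "a \<noteq> b" "a \<in> V" "b \<in> V" using e by (auto simp: card_2_iff)
  obtain p q where pq: "f = {p, q}" "p \<noteq> q" "p \<in> V" "q \<in> V" using f by (auto simp: card_2_iff)
  have sub: "{a, b} \<subseteq> pair_line f" "{p, q} \<subseteq> pair_line e"
    using subset_pair_line[of e] subset_pair_line[of f] eq ab(1) pq(1) by auto
  show ?thesis
  proof (cases "cls a = cls b")
    case True
    then have "pair_line e = {a, b}" using pair_line_twins ab by auto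
    then show ?thesis using sub(2) ab(1) pq(1,2) by auto
  next
    case ne: False
    show ?thesis
    proof (cases "cls p = cls q")
      case True
      then have "pair_line f = {p, q}" using pair_line_twins pq by auto
      then show ?thesis using sub(1) ab(1,2) pq(1) by auto
    next
      case False
      then show ?thesis
        using partial_pair_line[of a b] partial_pair_line[of p q] ne ab pq eq by auto
    qed
  qed
qed

lemma twinned_subset: "twinned \<subseteq> V"
  by (auto simp: twinned_def)

lemma twinnedI: "x \<in> V \<Longrightarrow> y \<in> V \<Longrightarrow> y \<noteq> x \<Longrightarrow> cls y = cls x \<Longrightarrow> x \<in> twinned"
  by (auto simp: twinned_def)

lemma ex_twin:
  assumes "p \<in> twinned"
  obtains q where "q \<in> twinned" "q \<noteq> p" "cls q = cls p"
proof -
  obtain q where q: "q \<in> V" "q \<noteq> p" "cls q = cls p" using assms by (auto simp: twinned_def)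
  moreover have "q \<in> twinned"
    using twinnedI[of q p] assms q twinned_subset by (metis subsetD)
  ultimately show thesis using that by blast
qed

lemma inj_on_pairs_twinned: "inj_on pair_line (pairs twinned)"
proof (rule inj_onI)
  fix e f assume "e \<in> pairs twinned" "f \<in> pairs twinned" and eq: "pair_line e = pair_line f"
  then have "e \<subseteq> twinned" "card e = 2" "f \<subseteq> twinned" "card f = 2" by (auto simp: pairs_def)
  with pair_line_eq_imp[of e f] eq twinned_subset show "e = f" by blast
qed

lemma inj_on_pair_line:
  assumes s: "s \<in> V - twinned" and K: "K \<subseteq> V - twinned"
    and d2: "\<And>x y. x \<in> K \<Longrightarrow> y \<in> K \<Longrightarrow> x \<noteq> y \<Longrightarrow> d x y = 2"
  shows "inj_on pair_line (pairs twinned \<union> (\<lambda>x. {s, x}) ` twinned \<union> pairs K)"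
    (is "inj_on _ ?E")
proof (rule inj_onI)
  have line_K: "pair_line e \<inter> K = e" if e: "e \<in> pairs K" for e
  proof -
    obtain a b where ab: "e = {a, b}" "a \<noteq> b" "a \<in> K" "b \<in> K"
      using e by (auto simp: pairs_def card_2_iff)
    have "c \<notin> pair_line {a, b}" if "c \<in> K" "c \<noteq> a" "c \<noteq> b" for c
      using pair_line_iff[of a b c] d2 ab that K by auto
    then show ?thesis using ab subset_pair_line[of e] by auto
  qed
  have two: "e \<subseteq> V \<and> card e = 2" if "e \<in> ?E" for e
    using that s K twinned_subset by (auto simp: pairs_def card_2_iff)
  have shape: "e \<subseteq> twinned \<and> card (e \<inter> twinned) = 2
      \<or> e = insert s (e \<inter> twinned) \<and> card (e \<inter> twinned) = 1
      \<or> e \<in> pairs K \<and> card (e \<inter> twinned) = 0" if e: "e \<in> ?E" for e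
  proof -
    consider "e \<in> pairs twinned" | x where "x \<in> twinned" "e = {s, x}" | "e \<in> pairs K"
      using e by auto
    then show ?thesis
    proof cases
      case 1
      then have "e \<inter> twinned = e" "e \<subseteq> twinned" "card e = 2" by (auto simp: pairs_def)
      then show ?thesis by auto
    next
      case 2
      then have "e \<inter> twinned = {x}" using s by auto
      then show ?thesis using 2 by auto
    next
      case 3
      then have "e \<inter> twinned = {}" using K by (auto simp: pairs_def)
      then show ?thesis using 3 by auto
    qed
  qed
  fix e f assume ef: "e \<in> ?E" "f \<in> ?E" and eq: "pair_line e = pair_line f"
  have I: "e \<inter> twinned = f \<inter> twinned"
    using pair_line_eq_imp two[OF ef(1)] two[OF ef(2)] eq by blast
  have "card (e \<inter> twinned) = card (f \<inter> twinned)" using I by simp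
  with shape[OF ef(1)] shape[OF ef(2)]
  consider "e \<subseteq> twinned" "f \<subseteq> twinned"
    | "e = insert s (e \<inter> twinned)" "f = insert s (f \<inter> twinned)"
    | "e \<in> pairs K" "f \<in> pairs K" by linarith
  then show "e = f"
  proof cases
    case 1 then show ?thesis using I by blast
  next
    case 2 then show ?thesis using I by metis
  next
    case 3 then show ?thesis using line_K eq by metis
  qed
qed

theorem card_le_card_pair_lines:
  assumes card: "card V \<ge> 3"
    and indep: "\<And>s t. s \<in> V - twinned \<Longrightarrow> t \<in> V - twinned \<Longrightarrow> d s t \<noteq> 1"
    and nbr: "\<And>s. s \<in> V - twinned \<Longrightarrow> \<exists>p\<in>twinned. d s p = 1"
  shows "card V \<le> card (pair_line ` pairs V)"
proof -
  let ?P = twinned and ?S = "V - twinned"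
  have fin: "finite ?P" "finite ?S" using finite_V twinned_subset finite_subset by auto
  have split: "card V = card ?P + card ?S"
    using card_Diff_subset[OF fin(1) twinned_subset] card_mono[OF finite_V twinned_subset] by simp
  have large: "card E \<le> card (pair_line ` pairs V)"
    if "inj_on pair_line E" "E \<subseteq> pairs V" for E
    using that finite_pairs[OF finite_V]
    by (metis card_image card_mono finite_imageI image_mono)
  show ?thesis
  proof (cases "?S = {}")
    case True
    have "card ?P \<le> card (pairs ?P)"
    proof -
      have "2 * card ?P \<le> card ?P * (card ?P - 1)"
        using card split True mult_le_mono2[of 2 "card ?P - 1" "card ?P"] by simp
      then show ?thesis using choose_two_twice[of "card ?P"] card_pairs[OF fin(1)] by linarith
    qed
    also have "\<dots> \<le> card (pair_line ` pairs V)"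
      using large[OF inj_on_pairs_twinned] twinned_subset by (auto simp: pairs_def)
    finally show ?thesis using split True by (metis add.right_neutral card.empty)
  next
    case False
    then obtain s where s: "s \<in> ?S" by blast
    then obtain p where p: "p \<in> ?P" using nbr by blast
    then obtain p' where p': "p' \<in> ?P" "p' \<noteq> p" using ex_twin by metis
    have N: "card ?P \<ge> 2" using card_mono[OF fin(1), of "{p, p'}"] p p' by auto
    define nb where "nb q = {t \<in> ?S. d t q = 1}" for q
    define k where "k = Max ((\<lambda>q. card (nb q)) ` ?P)"
    have k_le: "card (nb q) \<le> k" if "q \<in> ?P" for q
      unfolding k_def using that fin by auto
    have "k \<in> (\<lambda>q. card (nb q)) ` ?P"
      unfolding k_def by (rule Max_in) (use fin p in auto)
    then obtain v where v: "v \<in> ?P" "card (nb v) = k" by blast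
    have two_nbrs: "2 \<le> card {q \<in> ?P. d t q = 1}" if t: "t \<in> ?S" for t
    proof -
      obtain q where q: "q \<in> ?P" "d t q = 1" using nbr t by blast
      then obtain q' where q': "q' \<in> V" "q' \<noteq> q" "cls q' = cls q" "q' \<in> ?P"
        using ex_twin twinned_subset by (metis subsetD)
      have "cls t \<noteq> cls q" using twinnedI[of t q] t q twinned_subset by (metis DiffD1 DiffD2 subsetD)
      then have "d q t = d q' t" using d_twin_eq[of q q' t] q q' t twinned_subset by auto
      then have "d t q' = 1" using q q' t d_sym twinned_subset by (metis DiffD1 subsetD)
      then show ?thesis
        using card_mono[of "{q \<in> ?P. d t q = 1}" "{q, q'}"] fin q q' by auto
    qed
    have "2 * card ?S \<le> (\<Sum>t\<in>?S. card {q \<in> ?P. d t q = 1})"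
      using sum_mono[of ?S "\<lambda>_. 2" "\<lambda>t. card {q \<in> ?P. d t q = 1}"] two_nbrs by simp
    also have "\<dots> = (\<Sum>q\<in>?P. card (nb q))"
      unfolding nb_def by (rule sum_multicount_gen[OF fin(2,1)]) simp
    also have "\<dots> \<le> card ?P * k"
      using sum_mono[of ?P "\<lambda>q. card (nb q)" "\<lambda>_. k"] k_le by simp
    finally have S_le: "card ?S \<le> (card ?P choose 2) + (k choose 2)"
      using product_le_choose_two[OF N, of k] by linarith
    let ?K = "nb v"
    have K: "?K \<subseteq> ?S" by (auto simp: nb_def)
    have d2: "d x y = 2" if "x \<in> ?K" "y \<in> ?K" "x \<noteq> y" for x y
    proof -
      have xy: "x \<in> ?S" "y \<in> ?S" "d x v = 1" "d y v = 1" using that by (auto simp: nb_def)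
      then have "d x y \<le> 2"
        using d_triangle[of x v y] d_sym[of v y] v twinned_subset by auto
      then show ?thesis using indep[of x y] d_zero[of x y] xy that(3) by force
    qed
    let ?A = "pairs ?P" and ?B = "(\<lambda>x. {s, x}) ` ?P" and ?C = "pairs ?K"
    have finK: "finite ?K" using K fin finite_subset by blast
    have "card ?B = card ?P"
      by (rule card_image) (auto simp: inj_on_def doubleton_eq_iff)
    moreover have "?A \<inter> ?B = {}" using s by (auto simp: pairs_def)
    moreover have "(?A \<union> ?B) \<inter> ?C = {}"
    proof -
      have "e \<inter> ?P \<noteq> {}" if "e \<in> ?A \<union> ?B" for e
        using that by (auto simp: pairs_def card_2_iff)
      moreover have "e \<inter> ?P = {}" if "e \<in> ?C" for e
        using that K by (auto simp: pairs_def)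
      ultimately show ?thesis by blast
    qed
    ultimately have "card (?A \<union> ?B \<union> ?C) = (card ?P choose 2) + card ?P + (k choose 2)"
      using fin finK v by (simp add: card_Un_disjoint card_pairs finite_pairs)
    moreover have "?A \<union> ?B \<union> ?C \<subseteq> pairs V"
      using s K twinned_subset by (auto simp: pairs_def card_2_iff)
    ultimately show ?thesis
      using large[OF inj_on_pair_line[OF s K d2]] S_le split by simp
  qed
qed

end

section \<open>Twin classes of a split bipartite graph\<close>

definition twin_classes :: "'a pair_pre_digraph \<Rightarrow> ('a \<Rightarrow> 'a) \<Rightarrow> ('a \<Rightarrow> bool) \<Rightarrow> bool" where
  "twin_classes G cls col \<longleftrightarrow>
     (\<forall>x y. (x, y) \<in> parcs G \<longrightarrow> cls x \<noteq> cls y \<longrightarrow> col x \<noteq> col y) \<and>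
     (\<forall>x\<in>pverts G. \<forall>y\<in>pverts G. cls x = cls y \<longrightarrow> x \<noteq> y \<longrightarrow> col x = col y \<and>
       (x, y) \<in> parcs G \<and> (\<forall>z. z \<noteq> y \<longrightarrow> (x, z) \<in> parcs G \<longrightarrow> (y, z) \<in> parcs G))"

lemma pair_graph_sym: "pair_graph G \<Longrightarrow> (x, y) \<in> parcs G \<Longrightarrow> (y, x) \<in> parcs G"
proof -
  assume "pair_graph G"
  then interpret pair_graph G .
  show "(x, y) \<in> parcs G \<Longrightarrow> (y, x) \<in> parcs G"
    using pair_sym_arcs by (auto simp: symmetric_def dest: symD)
qed

lemma twin_classes_split_twin:
  assumes G: "pair_graph G" and tc: "twin_classes G cls col"
    and v: "v \<in> pverts G" and v': "v' \<notin> pverts G"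
  shows "twin_classes (split_twin G v v') (cls(v' := cls v)) (col(v' := col v))"
proof -
  interpret pair_graph G by fact
  have V: "x \<in> pverts G" "y \<in> pverts G" if "(x, y) \<in> parcs G" for x y
    using that in_arcsD1 in_arcsD2 by auto
  have new: "x \<noteq> v'" "y \<noteq> v'" if "(x, y) \<in> parcs G" for x y
    using V[OF that] v' by auto
  have ne: "x \<noteq> y" if "(x, y) \<in> parcs G" for x y
    using pair_no_loops[OF that] by simp
  note sym = pair_graph_sym[OF G]
  have tc1: "col x \<noteq> col y" if "(x, y) \<in> parcs G" "cls x \<noteq> cls y" for x y
    using tc that unfolding twin_classes_def by blast
  have tc2: "col x = col y" "(x, y) \<in> parcs G" "z \<noteq> y \<Longrightarrow> (x, z) \<in> parcs G \<Longrightarrow> (y, z) \<in> parcs G"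
    if "x \<in> pverts G" "y \<in> pverts G" "cls x = cls y" "x \<noteq> y" for x y z
    using tc that unfolding twin_classes_def by blast+
  have arc: "(x, y) \<in> parcs (split_twin G v v') \<longleftrightarrow> (x, y) \<in> parcs G \<or> x = v \<and> y = v' \<or> x = v' \<and> y = v
      \<or> x = v' \<and> (v, y) \<in> parcs G \<or> y = v' \<and> (v, x) \<in> parcs G" for x y
    by (auto simp: split_twin_def)
  have vv': "v \<noteq> v'" using v v' by auto
  have cls_v: "col y = col v" "y = v \<or> (v, y) \<in> parcs G" if "y \<in> pverts G" "cls y = cls v" for y
    using tc2(1)[of v y] tc2(2)[of v y] that v by metis+
  show ?thesis
    unfolding twin_classes_def
  proof (intro conjI allI ballI impI)
    fix x y
    assume "(x, y) \<in> parcs (split_twin G v v')" "(cls(v' := cls v)) x \<noteq> (cls(v' := cls v)) y"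
    then show "(col(v' := col v)) x \<noteq> (col(v' := col v)) y"
      unfolding arc using new tc1 sym by (auto split: if_splits)
  next
    fix x y
    assume xy: "x \<in> pverts (split_twin G v v')" "y \<in> pverts (split_twin G v v')"
      "(cls(v' := cls v)) x = (cls(v' := cls v)) y" "x \<noteq> y"
    then consider "x = v'" "y \<in> pverts G" "cls y = cls v" "y \<noteq> v'"
      | "y = v'" "x \<in> pverts G" "cls x = cls v" "x \<noteq> v'"
      | "x \<in> pverts G" "y \<in> pverts G" "x \<noteq> v'" "y \<noteq> v'" "cls x = cls y"
      using v' by (fastforce simp: split_twin_def split: if_splits)
    note cases = this
    show "(col(v' := col v)) x = (col(v' := col v)) y"
      using cases cls_v(1) tc2(1)[of x y] xy(4) by cases simp_all
    show "(x, y) \<in> parcs (split_twin G v v')"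
      unfolding arc using cases cls_v(2)[of x] cls_v(2)[of y] tc2(2)[of x y] xy(4) by cases blast+
    fix z assume z: "z \<noteq> y" "(x, z) \<in> parcs (split_twin G v v')"
    show "(y, z) \<in> parcs (split_twin G v v')"
      using cases
    proof cases
      case 1
      then have "z = v \<or> (v, z) \<in> parcs G" using z new vv' v' V unfolding arc by blast
      then have "(y, z) \<in> parcs G"
        using 1 z(1) tc2(3)[of v y z] tc2(2)[of y v] v by metis
      then show ?thesis unfolding arc by blast
    next
      case 2
      then have "(x, z) \<in> parcs G" using z new ne unfolding arc by blast
      then have "z = v \<or> (v, z) \<in> parcs G"
        using 2 tc2(3)[of x v z] v by metis
      then show ?thesis unfolding arc using 2 by blast
    next
      case 3
      then have "(x, z) \<in> parcs G \<or> z = v' \<and> (x = v \<or> (v, x) \<in> parcs G)"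
        using z unfolding arc by blast
      then show ?thesis
      proof
        assume "(x, z) \<in> parcs G"
        then show ?thesis unfolding arc using 3 z(1) xy(4) tc2(3)[of x y z] by blast
      next
        assume zx: "z = v' \<and> (x = v \<or> (v, x) \<in> parcs G)"
        then have "y = v \<or> (v, y) \<in> parcs G"
          using 3 xy(4) tc2(2)[of v y] tc2(3)[of x y v] sym by metis
        then show ?thesis unfolding arc using zx by blast
      qed
    qed
  qed
qed

lemma ex_twin_classes:
  assumes "split_from_bipartite G"
  shows "\<exists>cls col. twin_classes G cls col"
  using assms
proof induction
  case (base G)
  then obtain U W where "U \<inter> W = {}" "parcs G \<subseteq> U \<times> W \<union> W \<times> U"
    by (auto simp: bipartite_def)
  then have "twin_classes G (\<lambda>x. x) (\<lambda>x. x \<in> U)" unfolding twin_classes_def by auto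
  then show ?case by blast
next
  case (split G v v')
  then show ?case
    using twin_classes_split_twin split_from_bipartite_pair_graph by metis
qed

section \<open>Distances as step counts\<close>

definition steps :: "'a pair_pre_digraph \<Rightarrow> 'a \<Rightarrow> 'a \<Rightarrow> nat" where
  "steps G x y = (LEAST k. (x, y) \<in> parcs G ^^ k)"

lemma awalk_iff_relpow:
  assumes "pair_graph G" "u \<in> pverts G"
  shows "(\<exists>p. pre_digraph.awalk (with_proj G) u p v \<and> length p = k) \<longleftrightarrow> (u, v) \<in> parcs G ^^ k"
  using assms(2)
proof (induction k arbitrary: u)
  interpret pair_graph G by fact
  case 0
  then show ?case by (auto simp: awalk_Nil_iff)
next
  interpret pair_graph G by fact
  case (Suc k)
  have "(\<exists>p. awalk u p v \<and> length p = Suc k)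
      \<longleftrightarrow> (\<exists>w. (u, w) \<in> parcs G \<and> (\<exists>p. awalk w p v \<and> length p = k))"
  proof
    assume "\<exists>p. awalk u p v \<and> length p = Suc k"
    then obtain e es where "awalk u (e # es) v" "length es = k" by (metis length_Suc_conv)
    then have "(u, snd e) \<in> parcs G" "awalk (snd e) es v" "length es = k"
      by (simp_all add: awalk_Cons_iff)
    then show "\<exists>w. (u, w) \<in> parcs G \<and> (\<exists>p. awalk w p v \<and> length p = k)" by blast
  next
    assume "\<exists>w. (u, w) \<in> parcs G \<and> (\<exists>p. awalk w p v \<and> length p = k)"
    then obtain w p where "(u, w) \<in> parcs G" "awalk w p v" "length p = k" by blast
    then have "awalk u ((u, w) # p) v \<and> length ((u, w) # p) = Suc k"
      by (simp add: awalk_Cons_iff)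
    then show "\<exists>p. awalk u p v \<and> length p = Suc k" by blast
  qed
  also have "\<dots> \<longleftrightarrow> (\<exists>w. (u, w) \<in> parcs G \<and> (w, v) \<in> parcs G ^^ k)"
    using Suc.IH in_arcsD2 by blast
  also have "\<dots> \<longleftrightarrow> (u, v) \<in> parcs G ^^ Suc k"
    by (meson relpow_Suc_D2 relpow_Suc_I2)
  finally show ?case .
qed

lemma gdist_eq_steps:
  assumes "pair_graph G" "u \<in> pverts G" "(u, v) \<in> parcs G ^^ k"
  shows "gdist G u v = ereal (real (steps G u v))"
proof -
  have "(u, v) \<in> parcs G ^^ steps G u v" unfolding steps_def by (rule LeastI, rule assms)
  then obtain p where p: "pre_digraph.awalk (with_proj G) u p v" "length p = steps G u v"
    using awalk_iff_relpow[OF assms(1,2)] by blast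
  have "steps G u v \<le> length q" if "pre_digraph.awalk (with_proj G) u q v" for q
    unfolding steps_def using that awalk_iff_relpow[OF assms(1,2), of v "length q"]
    by (intro Least_le) auto
  then show ?thesis
    unfolding gdist_eq_length[OF assms(1)]
    using p by (intro antisym INF_greatest INF_lower2[of p]) auto
qed

lemma gdist_eq_infinity:
  assumes "pair_graph G" "u \<in> pverts G" "\<And>k. (u, v) \<notin> parcs G ^^ k"
  shows "gdist G u v = \<infinity>"
proof -
  have "{p. pre_digraph.awalk (with_proj G) u p v} = {}"
    using awalk_iff_relpow[OF assms(1,2)] assms(3) by blast
  then show ?thesis unfolding gdist_eq_length[OF assms(1)] by (simp add: top_ereal_def)
qed

lemma gdist_nonneg: "pair_graph G \<Longrightarrow> 0 \<le> gdist G u v"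
  unfolding gdist_eq_length by (rule INF_greatest) simp

lemma disconnected_has_universal_line:
  assumes G: "pair_graph G" and u: "u \<in> pverts G" and v: "v \<in> pverts G"
    and uv: "\<And>k. (u, v) \<notin> parcs G ^^ k"
  shows "has_universal_line G"
proof -
  have "between G u c v" if c: "c \<in> pverts G" for c
  proof -
    have "gdist G u c = \<infinity> \<or> gdist G c v = \<infinity>"
    proof (rule ccontr)
      assume "\<not> ?thesis"
      then obtain i j where "(u, c) \<in> parcs G ^^ i" "(c, v) \<in> parcs G ^^ j"
        using gdist_eq_infinity[OF G] u c by metis
      then have "(u, v) \<in> parcs G ^^ (i + j)" by (auto simp: relpow_add)
      then show False using uv by blast
    qed
    then show ?thesis
      using gdist_nonneg[OF G, of u c] gdist_nonneg[OF G, of c v] gdist_eq_infinity[OF G u uv]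
      unfolding between_def by auto
  qed
  then have "line G u v = pverts G"
    using u v uv[of 0] by (auto simp: line_def collinear3_def)
  then show ?thesis
    using u v uv[of 0] unfolding has_universal_line_def lines_def by force
qed

locale connected_twin_graph = pair_graph G for G :: "'a pair_pre_digraph" +
  fixes cls :: "'a \<Rightarrow> 'a" and col :: "'a \<Rightarrow> bool"
  assumes twin_classes: "twin_classes G cls col"
    and connected: "x \<in> pverts G \<Longrightarrow> y \<in> pverts G \<Longrightarrow> \<exists>k. (x, y) \<in> parcs G ^^ k"
begin

lemma arc_sym: "(x, y) \<in> parcs G \<Longrightarrow> (y, x) \<in> parcs G"
  by (rule pair_graph_sym[OF pair_graph_axioms])

lemma col_arc: "(x, y) \<in> parcs G \<Longrightarrow> cls x \<noteq> cls y \<Longrightarrow> col x \<noteq> col y"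
  using twin_classes unfolding twin_classes_def by blast

lemma twin_arc:
  assumes "x \<in> pverts G" "y \<in> pverts G" "cls x = cls y" "x \<noteq> y"
  shows "(x, y) \<in> parcs G" "z \<noteq> y \<Longrightarrow> (x, z) \<in> parcs G \<Longrightarrow> (y, z) \<in> parcs G"
  using assms twin_classes unfolding twin_classes_def by blast+

lemma steps_le: "(x, y) \<in> parcs G ^^ k \<Longrightarrow> steps G x y \<le> k"
  unfolding steps_def by (rule Least_le)

lemma relpow_steps: "x \<in> pverts G \<Longrightarrow> y \<in> pverts G \<Longrightarrow> (x, y) \<in> parcs G ^^ steps G x y"
  unfolding steps_def using connected LeastI by metis

lemma relpow_sym: "(x, y) \<in> parcs G ^^ k \<Longrightarrow> (y, x) \<in> parcs G ^^ k"
proof (induction k arbitrary: y)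
  case (Suc k)
  then obtain w where "(x, w) \<in> parcs G ^^ k" "(w, y) \<in> parcs G" by auto
  then show ?case using Suc.IH arc_sym relpow_Suc_I2 by metis
qed simp

lemma steps_sym: "steps G x y = steps G y x"
  unfolding steps_def using relpow_sym by metis

lemma steps_zero: "x \<in> pverts G \<Longrightarrow> y \<in> pverts G \<Longrightarrow> steps G x y = 0 \<longleftrightarrow> x = y"
  using relpow_steps[of x y] steps_le[of x y 0] by auto

lemma steps_one: "x \<in> pverts G \<Longrightarrow> y \<in> pverts G \<Longrightarrow> steps G x y = 1 \<longleftrightarrow> (x, y) \<in> parcs G"
proof
  assume xy: "x \<in> pverts G" "y \<in> pverts G"
  show "(x, y) \<in> parcs G" if "steps G x y = 1" using relpow_steps[OF xy] that by simp
  assume a: "(x, y) \<in> parcs G"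
  then have "x \<noteq> y" using pair_no_loops by fastforce
  then show "steps G x y = 1" using steps_zero[OF xy] steps_le[of x y 1] a by simp
qed

lemma steps_triangle:
  assumes "x \<in> pverts G" "y \<in> pverts G" "z \<in> pverts G"
  shows "steps G x z \<le> steps G x y + steps G y z"
  using relpow_steps[OF assms(1,2)] relpow_steps[OF assms(2,3)]
  by (intro steps_le) (auto simp: relpow_add)

lemma steps_twin_le:
  assumes xy: "x \<in> pverts G" "y \<in> pverts G" "cls x = cls y" "x \<noteq> y"
    and z: "z \<in> pverts G" "z \<noteq> x"
  shows "steps G y z \<le> steps G x z"
proof -
  obtain k where k: "steps G x z = Suc k" using steps_zero[of x z] xy z by (cases "steps G x z") auto
  then obtain w where w: "(x, w) \<in> parcs G" "(w, z) \<in> parcs G ^^ k"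
    using relpow_steps[of x z] xy z by (metis relpow_Suc_D2)
  show ?thesis
  proof (cases "w = y")
    case True
    then show ?thesis using steps_le[OF w(2)] k by simp
  next
    case False
    then have "(y, z) \<in> parcs G ^^ Suc k" using twin_arc(2)[OF xy] w relpow_Suc_I2 by metis
    then show ?thesis using steps_le k by metis
  qed
qed

lemma steps_twin_eq:
  assumes "x \<in> pverts G" "y \<in> pverts G" "cls x = cls y" "z \<in> pverts G" "z \<noteq> x" "z \<noteq> y"
  shows "steps G x z = steps G y z"
proof (cases "x = y")
  case False
  then show ?thesis using steps_twin_le[of x y z] steps_twin_le[of y x z] assms by auto
qed simp

sublocale twin_metric "pverts G" "steps G" cls
proof
  show "steps G x z = steps G y z"
    if "x \<in> pverts G" "y \<in> pverts G" "z \<in> pverts G" "cls x = cls y" "cls z \<noteq> cls x" for x y z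
    using steps_twin_eq[of x y z] that by auto
  show "steps G x y = 1" if "x \<in> pverts G" "y \<in> pverts G" "cls x = cls y" "x \<noteq> y" for x y
    using steps_one twin_arc(1) that by blast
qed (rule pair_finite_verts steps_zero steps_sym steps_triangle; assumption)+

text \<open>A shortest path between vertices of different classes uses no edge inside a class.\<close>

lemma col_eq_iff_even_steps:
  assumes "c \<in> pverts G" "z \<in> pverts G" "cls z \<noteq> cls c"
  shows "col c = col z \<longleftrightarrow> even (steps G c z)"
  using assms(2,3)
proof (induction "steps G c z" arbitrary: z)
  case 0
  then show ?case using steps_zero[of c z] assms by auto
next
  case (Suc k)
  then have "(c, z) \<in> parcs G ^^ Suc k" using relpow_steps[of c z] assms(1) by simp
  then obtain w where w: "(c, w) \<in> parcs G ^^ k" "(w, z) \<in> parcs G" by auto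
  have V: "w \<in> pverts G" using w in_arcsD1 by auto
  have "steps G c z \<le> Suc (steps G c w)"
    using relpow_steps[OF assms(1) V] w(2) by (intro steps_le) auto
  then have k: "steps G c w = k" using steps_le[OF w(1)] Suc.hyps(2) by simp
  show ?case
  proof (cases "w = c")
    case True
    then have "steps G c z = 1" using w(2) steps_one assms Suc.prems by auto
    then show ?thesis using col_arc[of c z] True w(2) Suc.prems by auto
  next
    case False
    have wc: "cls w \<noteq> cls c"
    proof
      assume "cls w = cls c"
      then have "(c, z) \<in> parcs G" using twin_arc(2)[of w c z] V assms False w(2) Suc.prems by auto
      then have "k = 0" using steps_one[of c z] assms Suc by simp
      then show False using k steps_zero[of c w] False V assms by auto
    qed
    have "cls w \<noteq> cls z"
    proof
      assume "cls w = cls z"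
      then have "steps G w c = steps G z c"
        using steps_twin_eq[of w z c] V Suc.prems assms False by auto
      then show False using k Suc.hyps(2) steps_sym by (metis n_not_Suc_n)
    qed
    then have "col w \<noteq> col z" using col_arc w(2) by auto
    moreover have "col c = col w \<longleftrightarrow> even k" using Suc.hyps(1)[of w] k V wc by auto
    ultimately show ?thesis using Suc.hyps(2) by (metis even_Suc)
  qed
qed

lemma line_eq_pair_line:
  assumes "a \<in> pverts G" "b \<in> pverts G" "a \<noteq> b"
  shows "line G a b = pair_line {a, b}"
proof -
  have g: "gdist G x y = ereal (real (steps G x y))" if "x \<in> pverts G" "y \<in> pverts G" for x y
    using gdist_eq_steps[OF pair_graph_axioms] connected that by metis
  have "between G x y z \<longleftrightarrow> steps G x y + steps G y z = steps G x z"
    if "x \<in> pverts G" "y \<in> pverts G" "z \<in> pverts G" for x y z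
    unfolding between_def using g that by (simp flip: of_nat_add)
  then have "c \<in> line G a b \<longleftrightarrow> c \<in> pair_line {a, b}" if "c \<in> pverts G" "c \<noteq> a" "c \<noteq> b" for c
    using pair_line_iff[OF assms that] assms that steps_sym
    by (auto simp: line_def collinear3_def)
  moreover have "line G a b \<subseteq> pverts G" "{a, b} \<subseteq> line G a b"
    using assms by (auto simp: line_def)
  ultimately show ?thesis
    using subset_pair_line[of "{a, b}"] pair_line_subset[of "{a, b}"] assms by blast
qed

lemma lines_eq: "lines G = pair_line ` pairs (pverts G)"
proof -
  have "lines G = {pair_line {a, b} | a b. a \<in> pverts G \<and> b \<in> pverts G \<and> a \<noteq> b}"
    unfolding lines_def using line_eq_pair_line by metis
  also have "\<dots> = pair_line ` pairs (pverts G)"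
    unfolding pairs_def by (auto simp: card_2_iff)
  finally show ?thesis .
qed

lemma untwinned_arc_has_universal_line:
  assumes x: "x \<in> pverts G - twinned" and y: "y \<in> pverts G - twinned" and xy: "(x, y) \<in> parcs G"
  shows "has_universal_line G"
proof -
  have ne: "x \<noteq> y" using pair_no_loops[OF xy] by simp
  have "cls x \<noteq> cls y" using twinnedI[of x y] x y ne by auto
  then have col: "col x \<noteq> col y" using col_arc xy by blast
  have "c \<in> pair_line {x, y}" if c: "c \<in> pverts G" "c \<noteq> x" "c \<noteq> y" for c
  proof -
    have "cls x \<noteq> cls c" "cls y \<noteq> cls c" using twinnedI[of x c] twinnedI[of y c] c x y by auto
    then have "steps G c x \<noteq> steps G c y"
      using col_eq_iff_even_steps[of c x] col_eq_iff_even_steps[of c y] col c x y by auto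
    moreover have "steps G x y = 1" using steps_one x y xy by auto
    ultimately have "steps G x y + steps G y c = steps G x c \<or> steps G x y + steps G x c = steps G y c"
      using steps_triangle[of x y c] steps_triangle[of y x c] x y c
        steps_sym[of x c] steps_sym[of y c] steps_sym[of x y] by auto
    then show ?thesis using pair_line_iff[of x y c] x y ne c by auto
  qed
  then have "pair_line {x, y} = pverts G"
    using pair_line_subset[of "{x, y}"] subset_pair_line[of "{x, y}"] x y by blast
  moreover have "{x, y} \<in> pairs (pverts G)" using x y ne by (auto simp: pairs_def)
  ultimately show ?thesis unfolding has_universal_line_def lines_eq by blast
qed

lemma universal_or_many_lines:
  assumes n: "card (pverts G) \<ge> 2"
  shows "has_universal_line G \<or> card (lines G) \<ge> card (pverts G)"
proof (cases "card (pverts G) = 2")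
  case True
  then have "pverts G \<in> pairs (pverts G)" by (simp add: pairs_def)
  moreover have "pair_line (pverts G) = pverts G"
    using subset_pair_line pair_line_subset by blast
  ultimately show ?thesis unfolding has_universal_line_def lines_eq by force
next
  case False
  show ?thesis
  proof (cases "has_universal_line G")
    case no: False
    have indep: "steps G s t \<noteq> 1" if "s \<in> pverts G - twinned" "t \<in> pverts G - twinned" for s t
      using untwinned_arc_has_universal_line[OF that] no steps_one that by auto
    have "\<exists>p\<in>twinned. steps G s p = 1" if s: "s \<in> pverts G - twinned" for s
    proof -
      have "\<not> pverts G \<subseteq> {s}" using n card_mono[of "{s}" "pverts G"] by auto
      then obtain y where y: "y \<in> pverts G" "y \<noteq> s" by blast
      then obtain k where "steps G s y = Suc k"
        using steps_zero[of s y] s by (cases "steps G s y") auto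
      then obtain p where "(s, p) \<in> parcs G"
        using relpow_steps[of s y] s y by (metis DiffD1 relpow_Suc_D2)
      then have "p \<in> pverts G" "steps G s p = 1" using in_arcsD2 steps_one s by auto
      then show ?thesis using indep[OF s, of p] by blast
    qed
    then show ?thesis
      using card_le_card_pair_lines indep n False unfolding lines_eq by auto
  qed simp
qed

end

theorem theorem1:
  fixes G :: "'a pair_pre_digraph" and n :: nat
  assumes "pair_graph G"
    and "card (pverts G) = n"
    and "n \<ge> 2"
    and "split_from_bipartite G"
  shows "has_universal_line G \<or> card (lines G) \<ge> n"
proof (cases "\<forall>x\<in>pverts G. \<forall>y\<in>pverts G. \<exists>k. (x, y) \<in> parcs G ^^ k")
  case True
  obtain cls col where "twin_classes G cls col" using ex_twin_classes[OF assms(4)] by blast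
  then have "connected_twin_graph G cls col"
    using assms(1) True by (auto simp: connected_twin_graph_def connected_twin_graph_axioms_def)
  then show ?thesis using connected_twin_graph.universal_or_many_lines assms(2,3) by blast
next
  case False
  then show ?thesis using disconnected_has_universal_line[OF assms(1)] by blast
qed

end
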